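(* For $i=1,2$ let $f_i(\boldsymbol{x})=\phi(\boldsymbol{x};\boldsymbol{\mu}_i,\Sigma_i)$ be densities of bivariate normal distributions, with $\boldsymbol{\mu}_i\in\mathbb{R}^2$ and $\Sigma_i$ a positive definite symmetric $2\times2$ matrix, and for $0\le c\le 1$ let $M_c=cf_1+(1-c)f_2:\mathbb{R}^2\to\mathbb{R}_{>0}$. Suppose $\Sigma_1$ and $\Sigma_2$ are not proportional, and $f_1$ and $f_2$ are codirectional. Then the number of modes of $M_c$ is less than or equal to $2$.
   Context: The bivariate normal density is $\phi(\boldsymbol{x};\boldsymbol{\mu},\Sigma)=\frac{1}{2\pi|\Sigma|^{1/2}}\exp\left(-\frac12(\boldsymbol{x}-\boldsymbol{\mu})^T\Sigma^{-1}(\boldsymbol{x}-\boldsymbol{\mu})\right)$, $\boldsymbol{x}\in\mathbb{R}^2$. $\Sigma_1,\Sigma_2$ are proportional if there is a constant $k>0$ with $\Sigma_1=k\Sigma_2$. When $\Sigma_1$ and $\Sigma_2$ are not proportional, $f_1$ and $f_2$ are called codirectional if the vector $\boldsymbol{\mu}_1-\boldsymbol{\mu}_2$ is an eigenvector of both $\Sigma_1$ and $\Sigma_2$ (in particular $\boldsymbol{\mu}_1\neq\boldsymbol{\mu}_2$). A mode of $M_c$ is a local maximum point of $M_c$ on $\mathbb{R}^2$. *)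

theory Defs
  imports "HOL-Analysis.Analysis"
begin

definition pos_def_symmetric :: "real^2^2 \<Rightarrow> bool" where
  "pos_def_symmetric S \<longleftrightarrow> transpose S = S \<and> (\<forall>x. x \<noteq> 0 \<longrightarrow> x \<bullet> (S *v x) > 0)"

definition bivariate_normal_density :: "real^2 \<Rightarrow> real^2^2 \<Rightarrow> real^2 \<Rightarrow> real" where
  "bivariate_normal_density \<mu> S x =
     1 / (2 * pi * sqrt (det S)) * exp (- (1 / 2) * ((x - \<mu>) \<bullet> (matrix_inv S *v (x - \<mu>))))"

definition mixture :: "real \<Rightarrow> ('a \<Rightarrow> real) \<Rightarrow> ('a \<Rightarrow> real) \<Rightarrow> 'a \<Rightarrow> real" where
  "mixture c f g x = c * f x + (1 - c) * g x"

definition proportional :: "real^2^2 \<Rightarrow> real^2^2 \<Rightarrow> bool" where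
  "proportional S T \<longleftrightarrow> (\<exists>k>0. S = k *\<^sub>R T)"

definition is_eigenvector :: "real^2^2 \<Rightarrow> real^2 \<Rightarrow> bool" where
  "is_eigenvector S v \<longleftrightarrow> v \<noteq> 0 \<and> (\<exists>l. S *v v = l *\<^sub>R v)"

text \<open>
  Codirectionality of two normal densities is expressed through their parameters. The notion is
  meant for covariance matrices that are not proportional; that restriction is not part of the
  definition and has to be assumed separately.
\<close>

definition codirectional :: "real^2 \<Rightarrow> real^2^2 \<Rightarrow> real^2 \<Rightarrow> real^2^2 \<Rightarrow> bool" where
  "codirectional \<mu>1 S1 \<mu>2 S2 \<longleftrightarrow>
     is_eigenvector S1 (\<mu>1 - \<mu>2) \<and> is_eigenvector S2 (\<mu>1 - \<mu>2)"

text \<open>Modes are local maximum points in the non-strict sense.\<close>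

definition modes :: "('a::topological_space \<Rightarrow> real) \<Rightarrow> 'a set" where
  "modes f = {x. \<forall>\<^sub>F y in nhds x. f y \<le> f x}"

end

theory Submission
  imports Defs
begin

text \<open>
  The eigenvector \<open>v = \<mu>1 - \<mu>2\<close> and its rotation \<open>w\<close> by a right angle diagonalise both covariance
  matrices, so at \<open>\<mu>2 + t v + s w\<close> the mixture is
  \<open>a exp(- P (t - 1)\<^sup>2 - Q s\<^sup>2) + b exp(- P' t\<^sup>2 - Q' s\<^sup>2)\<close> with \<open>a, b \<ge> 0\<close>.
  This strictly decreases in \<open>\<bar>s\<bar>\<close>, so the modes lie on the line \<open>s = 0\<close>. On that line three modes
  would force five critical points. If \<open>a, b > 0\<close>, all critical points lie in \<open>(0, 1)\<close> and are
  level points of \<open>t / (1 - t) exp(P (t - 1)\<^sup>2 - P' t\<^sup>2)\<close>, so Rolle's theorem would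
  give four zeros of its derivative; but these are roots of a nonzero cubic.
\<close>

section \<open>Modes on the real line\<close>

lemma modes_real_iff:
  fixes g :: "real \<Rightarrow> real"
  shows "x \<in> modes g \<longleftrightarrow> (\<exists>d>0. \<forall>y. \<bar>y - x\<bar> < d \<longrightarrow> g y \<le> g x)"
  by (simp add: modes_def eventually_nhds_metric dist_real_def)

text \<open>Take a minimum \<open>m\<close> of \<open>g\<close> on \<open>[x, y]\<close>. If it is
  interior, the derivative vanishes there. If it is an endpoint, that endpoint is both a minimum on
  the interval and a local maximum, so \<open>g\<close> is constant nearby inside the interval and
  Rolle's theorem applies.\<close>

lemma critical_point_between_modes:
  fixes g g' :: "real \<Rightarrow> real"
  assumes der: "\<And>x. (g has_real_derivative g' x) (at x)"
    and "x \<in> modes g" "y \<in> modes g" "x < y"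
  obtains z where "x < z" "z < y" "g' z = 0"
proof -
  have cont: "continuous_on A g" for A
    using der by (meson DERIV_continuous_on DERIV_subset subset_UNIV)
  have rolle: "\<exists>z. u < z \<and> z < v \<and> g' z = 0" if "u < v" "g u = g v" for u v
    using Rolle[OF that cont] der DERIV_unique real_differentiable_def by metis
  obtain d where d: "d > 0" "\<And>u. \<bar>u - x\<bar> < d \<Longrightarrow> g u \<le> g x"
    using assms(2) unfolding modes_real_iff by blast
  obtain e where e: "e > 0" "\<And>u. \<bar>u - y\<bar> < e \<Longrightarrow> g u \<le> g y"
    using assms(3) unfolding modes_real_iff by blast
  obtain m where m: "x \<le> m" "m \<le> y" "\<And>u. x \<le> u \<Longrightarrow> u \<le> y \<Longrightarrow> g m \<le> g u"
    using continuous_attains_inf[of "{x..y}" g] cont \<open>x < y\<close> by auto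
  have "\<exists>z. x < z \<and> z < y \<and> g' z = 0"
  proof -
    consider "x < m" "m < y" | "m = x" | "m = y"
      using m(1,2) by linarith
    then show ?thesis
    proof cases
      case 1
      have "g' m = 0"
        by (rule DERIV_local_min[OF der, where d = "min (m - x) (y - m)"]) (use 1 m(3) in auto)
      with 1 show ?thesis by blast
    next
      case 2
      \<comment> \<open>Halving keeps \<open>u\<close> strictly inside both the interval and the
        neighbourhood on which \<open>g x\<close> is maximal, which gives inequalities in both
        directions between \<open>g u\<close> and \<open>g x\<close>.\<close>
      define u where "u = x + min (d / 2) ((y - x) / 2)"
      have u: "x < u" "u < y" "\<bar>u - x\<bar> < d"
        using d(1) \<open>x < y\<close> by (auto simp: u_def min_def field_simps)
      then have "g x = g u"
        using d(2)[of u] m(3)[of u] 2 by simp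
      with u rolle[of x u] show ?thesis by (meson less_trans)
    next
      case 3
      define u where "u = y - min (e / 2) ((y - x) / 2)"
      have u: "x < u" "u < y" "\<bar>u - y\<bar> < e"
        using e(1) \<open>x < y\<close> by (auto simp: u_def min_def field_simps)
      then have "g u = g y"
        using e(2)[of u] m(3)[of u] 3 by simp
      with u rolle[of u y] show ?thesis by (meson less_trans)
    qed
  qed
  with that show thesis by blast
qed

text \<open>Finiteness is claimed as well because \<open>card\<close> of an infinite set is 0, so
  the bound alone would not exclude that case.\<close>

lemma finite_card_le_2:
  fixes A :: "'a::linorder set"
  assumes "\<And>x y z. x \<in> A \<Longrightarrow> y \<in> A \<Longrightarrow> z \<in> A \<Longrightarrow> x < y \<Longrightarrow> y < z \<Longrightarrow> False"
  shows "finite A \<and> card A \<le> 2"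
proof (rule ccontr)
  assume "\<not> ?thesis"
  then have "infinite A \<or> 3 \<le> card A" by auto
  then obtain T where "T \<subseteq> A" "card T = 3"
    using infinite_arbitrarily_large obtain_subset_with_card_n by metis
  then obtain x y z where "x \<in> A" "y \<in> A" "z \<in> A" "x \<noteq> y" "y \<noteq> z" "x \<noteq> z"
    by (auto simp: card_3_iff)
  then show False
    using assms by (metis linorder_neqE)
qed

text \<open>Three modes are critical points themselves, and each of the two gaps between them
  contributes another one. Strictly increasing lists count critical points without presupposing that
  there are finitely many.\<close>

lemma card_modes_le_2:
  fixes g g' :: "real \<Rightarrow> real"
  assumes der: "\<And>x. (g has_real_derivative g' x) (at x)"
    and crit: "\<And>xs. sorted_wrt (<) xs \<Longrightarrow> (\<forall>x\<in>set xs. g' x = 0) \<Longrightarrow> length xs < 5"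
  shows "finite (modes g) \<and> card (modes g) \<le> 2"
proof (rule finite_card_le_2)
  fix x y z assume *: "x \<in> modes g" "y \<in> modes g" "z \<in> modes g" "x < y" "y < z"
  have zero: "g' u = 0" if u: "u \<in> modes g" for u
  proof -
    obtain d where d: "d > 0" "\<And>w. \<bar>w - u\<bar> < d \<Longrightarrow> g w \<le> g u"
      using u unfolding modes_real_iff by blast
    show ?thesis
      by (rule DERIV_local_max[OF der d(1)]) (use d(2) in \<open>auto simp: abs_minus_commute\<close>)
  qed
  obtain p where "x < p" "p < y" "g' p = 0"
    using critical_point_between_modes[OF der *(1,2,4)] .
  moreover obtain q where "y < q" "q < z" "g' q = 0"
    using critical_point_between_modes[OF der *(2,3,5)] .
  ultimately show False
    using crit[of "[x, p, y, q, z]"] zero * by auto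
qed

section \<open>Mixtures of two Gaussians on the real line\<close>

text \<open>The constant coefficient is 1, so the polynomial is nonzero even when
  \<open>P = R\<close> and the cubic term drops out. On \<open>(0, 1)\<close>, \<open>k t\<close> is
  \<open>t * (1 - t)\<close> times the derivative of
  \<open>ln (t / (1 - t)) + P * (t - 1)\<^sup>2 - R * t\<^sup>2\<close>.\<close>

lemma cubic_four_roots:
  fixes P R :: real
  defines "k \<equiv> \<lambda>t. 1 - 2 * t * (1 - t) * (P * (1 - t) + R * t)"
  assumes "y1 < y2" "y2 < y3" "y3 < y4" "k y1 = 0" "k y2 = 0" "k y3 = 0" "k y4 = 0"
  shows False
proof -
  let ?p = "[:1, -2*P, -2*(R - 2*P), 2*(R - P):]"
  have eq: "poly ?p t = k t" for t
    by (simp add: k_def algebra_simps power2_eq_square)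
  have "?p \<noteq> 0" by simp
  then have fin: "finite {t. poly ?p t = 0}"
    by (rule poly_roots_finite)
  from \<open>?p \<noteq> 0\<close> have "card {t. poly ?p t = 0} \<le> degree ?p"
    by (rule card_poly_roots_bound)
  also have "degree ?p \<le> 3" by simp
  finally have "card {t. poly ?p t = 0} \<le> 3" .
  moreover have "card {y1, y2, y3, y4} \<le> card {t. poly ?p t = 0}"
    by (rule card_mono[OF fin]) (use assms eq in auto)
  moreover have "card {y1, y2, y3, y4} = 4"
    using assms(2-4) by auto
  ultimately show False by simp
qed

lemma gaussian_mixture_critical_points:
  fixes a b P R :: real
  defines "g' \<equiv> \<lambda>t. - 2 * P * a * (t - 1) * exp (- P * (t - 1)\<^sup>2) - 2 * R * b * t * exp (- R * t\<^sup>2)"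
  assumes ab: "0 \<le> a" "0 \<le> b" "a > 0 \<or> b > 0" and PR: "P > 0" "R > 0"
    and xs: "sorted_wrt (<) xs" "\<forall>x\<in>set xs. g' x = 0"
  shows "length xs < 5"
proof (rule ccontr)
  assume "\<not> length xs < 5"
  then obtain x1 x2 x3 x4 x5 ys where "xs = x1 # x2 # x3 # x4 # x5 # ys"
    by (auto simp: not_less numeral_eq_Suc Suc_le_length_iff)
  with xs have x: "x1 < x2" "x2 < x3" "x3 < x4" "x4 < x5"
    and z: "g' x1 = 0" "g' x2 = 0" "g' x3 = 0" "g' x4 = 0" "g' x5 = 0" by auto
  \<comment> \<open>If one weight vanishes, the remaining Gaussian has its mean, 0 or 1, as its only
    critical point.\<close>
  consider "a = 0" "b > 0" | "b = 0" "a > 0" | "a > 0" "b > 0" using ab by linarith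
  then show False
  proof cases
    case 1
    with z(1,2) PR have "x1 = 0" "x2 = 0" by (auto simp: g'_def)
    with x show False by simp
  next
    case 2
    with z(1,2) PR have "x1 = 1" "x2 = 1" by (auto simp: g'_def)
    with x show False by simp
  next
    case 3
    define \<phi> where "\<phi> = (\<lambda>t. t / (1 - t) * exp (P * (t - 1)\<^sup>2 - R * t\<^sup>2))"
    have crit: "0 < t \<and> t < 1 \<and> \<phi> t = P * a / (R * b)" if "g' t = 0" for t
    proof -
      have eq: "P * a * (1 - t) * exp (- P * (t - 1)\<^sup>2) = R * b * t * exp (- R * t\<^sup>2)"
        using that by (simp add: g'_def algebra_simps)
      \<comment> \<open>All other factors in \<open>eq\<close> are positive. As \<open>1 - t\<close>
        and \<open>t\<close> sum to 1, equal signs force both to be positive.\<close>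
      have sgn_eq: "sgn (1 - t) = sgn t"
        using arg_cong[OF eq, of sgn] 3 PR by (simp add: sgn_mult)
      then have t: "0 < t" "t < 1"
        by (auto simp: sgn_if split: if_splits)
      have "P * a * (1 - t) = R * b * t * (exp (- R * t\<^sup>2) * exp (P * (t - 1)\<^sup>2))"
        using arg_cong[OF eq, of "\<lambda>u. u * exp (P * (t - 1)\<^sup>2)"]
        by (simp add: mult.assoc flip: exp_add)
      also have "exp (- R * t\<^sup>2) * exp (P * (t - 1)\<^sup>2) = exp (P * (t - 1)\<^sup>2 - R * t\<^sup>2)"
        by (simp flip: exp_add)
      finally show ?thesis
        using t 3 PR by (simp add: \<phi>_def frac_eq_eq mult.commute mult.left_commute)
    qed
    \<comment> \<open>The prefactor is positive, so below the pole at 1 the zeros of the derivative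
      are exactly those of the cubic.\<close>
    have der: "(\<phi> has_real_derivative exp (P * (t - 1)\<^sup>2 - R * t\<^sup>2) / (1 - t)\<^sup>2 *
        (1 - 2 * t * (1 - t) * (P * (1 - t) + R * t))) (at t)" if "t < 1" for t
      unfolding \<phi>_def using that
      by (auto intro!: derivative_eq_intros simp: divide_simps) (simp add: algebra_simps power2_eq_square)
    have rolle: "\<exists>y>u. y < v \<and> 1 - 2 * y * (1 - y) * (P * (1 - y) + R * y) = 0"
      if "u < v" "g' u = 0" "g' v = 0" for u v
    proof -
      have "v < 1" "\<phi> u = \<phi> v" using crit that by auto
      moreover have "continuous_on {u..v} \<phi>"
        using der \<open>v < 1\<close> by (meson DERIV_atLeastAtMost_imp_continuous_on le_less_trans)
      moreover have "\<phi> differentiable (at y)" if "y < v" for y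
        using der[of y] that \<open>v < 1\<close> real_differentiable_def by auto
      ultimately obtain y where y: "u < y" "y < v" "DERIV \<phi> y :> 0"
        using Rolle[OF \<open>u < v\<close>, of \<phi>] by blast
      with \<open>v < 1\<close> DERIV_unique[OF y(3) der] show ?thesis by auto
    qed
    obtain y1 where y1: "x1 < y1" "y1 < x2" "1 - 2 * y1 * (1 - y1) * (P * (1 - y1) + R * y1) = 0"
      using rolle x(1) z by blast
    obtain y2 where y2: "x2 < y2" "y2 < x3" "1 - 2 * y2 * (1 - y2) * (P * (1 - y2) + R * y2) = 0"
      using rolle x(2) z by blast
    obtain y3 where y3: "x3 < y3" "y3 < x4" "1 - 2 * y3 * (1 - y3) * (P * (1 - y3) + R * y3) = 0"
      using rolle x(3) z by blast
    obtain y4 where y4: "x4 < y4" "y4 < x5" "1 - 2 * y4 * (1 - y4) * (P * (1 - y4) + R * y4) = 0"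
      using rolle x(4) z by blast
    show False
      using y1 y2 y3 y4 by (intro cubic_four_roots[of y1 y2 y3 y4 P R]) auto
  qed
qed

lemma gaussian_mixture_modes:
  fixes a b P R :: real
  assumes "0 \<le> a" "0 \<le> b" "a > 0 \<or> b > 0" "P > 0" "R > 0"
  defines "g \<equiv> \<lambda>t. a * exp (- P * (t - 1)\<^sup>2) + b * exp (- R * t\<^sup>2)"
  shows "finite (modes g) \<and> card (modes g) \<le> 2"
proof (rule card_modes_le_2)
  show "(g has_real_derivative - 2 * P * a * (t - 1) * exp (- P * (t - 1)\<^sup>2)
      - 2 * R * b * t * exp (- R * t\<^sup>2)) (at t)" for t
    unfolding g_def by (auto intro!: derivative_eq_intros simp: algebra_simps)
qed (rule gaussian_mixture_critical_points[OF assms(1-5)])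

section \<open>Reduction to the line through the two means\<close>

text \<open>The first unit vector gives a positive upper left entry; at
  \<open>vector [- S $ 1 $ 2, S $ 1 $ 1]\<close> the quadratic form equals that entry times the
  determinant.\<close>

lemma pos_def_symmetric_det_pos:
  assumes "pos_def_symmetric S"
  shows "det S > 0"
proof -
  have "transpose S $ 1 $ 2 = S $ 1 $ 2"
    using assms by (simp add: pos_def_symmetric_def)
  then have sym: "S $ 2 $ 1 = S $ 1 $ 2"
    by (simp add: transpose_def)
  have pos: "x \<bullet> (S *v x) > 0" if "x \<noteq> 0" for x
    using assms that by (simp add: pos_def_symmetric_def)
  have "S $ 1 $ 1 > 0"
    using pos[of "vector [1, 0]"]
    by (simp add: inner_vec_def matrix_vector_mult_def sum_2 vec_eq_iff forall_2)
  moreover from this have "S $ 1 $ 1 * det S > 0"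
    using pos[of "vector [- S $ 1 $ 2, S $ 1 $ 1]"]
    by (simp add: inner_vec_def matrix_vector_mult_def sum_2 vec_eq_iff forall_2 det_2 sym algebra_simps)
  ultimately show ?thesis by (simp add: zero_less_mult_iff)
qed

text \<open>An eigenvector of \<open>S\<close> is also one of its inverse, so the cross term between
  \<open>v\<close> and the orthogonal \<open>w\<close> vanishes. The factor 2 cancels the 1/2 in the
  exponent of the density.\<close>

lemma quadratic_form_inverse_diagonal:
  assumes S: "pos_def_symmetric S" and v: "is_eigenvector S v" and w: "v \<bullet> w = 0" "w \<noteq> 0"
  obtains P Q where "P > 0" "Q > 0"
    "\<And>t s. (t *\<^sub>R v + s *\<^sub>R w) \<bullet> (matrix_inv S *v (t *\<^sub>R v + s *\<^sub>R w)) = 2 * (P * t\<^sup>2 + Q * s\<^sup>2)"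
proof -
  let ?N = "matrix_inv S"
  have "invertible S"
    using pos_def_symmetric_det_pos[OF S] invertible_det_nz by force
  then have "S ** ?N = mat 1 \<and> ?N ** S = mat 1"
    unfolding invertible_def matrix_inv_def by (rule someI_ex)
  then have SN: "S *v (?N *v x) = x" and NS: "?N *v (S *v x) = x" for x
    by (simp_all add: matrix_vector_mul_assoc)
  have sym: "(S *v x) \<bullet> y = x \<bullet> (S *v y)" for x y
    using S by (metis dot_lmul_matrix pos_def_symmetric_def transpose_matrix_vector)
  have N_sym: "x \<bullet> (?N *v y) = (?N *v x) \<bullet> y" for x y
    using sym[of "?N *v x" "?N *v y"] by (simp add: SN)
  have pos: "x \<bullet> (?N *v x) > 0" if "x \<noteq> 0" for x
  proof -
    have "?N *v x \<noteq> 0" using SN[of x] that by auto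
    then have "(?N *v x) \<bullet> (S *v (?N *v x)) > 0"
      using S by (simp add: pos_def_symmetric_def)
    then show ?thesis by (simp add: SN inner_commute)
  qed
  obtain l where "v \<noteq> 0" "S *v v = l *\<^sub>R v" using v by (auto simp: is_eigenvector_def)
  \<comment> \<open>Applying the inverse to the eigenvalue equation; since \<open>v\<close> is
    nonzero, this also rules out \<open>l = 0\<close>.\<close>
  then have "v = l *\<^sub>R (?N *v v)"
    using NS[of v] by (simp add: matrix_vector_mult_scaleR)
  then have "l * ((?N *v v) \<bullet> w) = 0" "l \<noteq> 0"
    using w(1) \<open>v \<noteq> 0\<close> by (metis inner_scaleR_left, auto)
  then have c: "(?N *v v) \<bullet> w = 0" by simp
  show thesis
  proof (rule that[of "v \<bullet> (?N *v v) / 2" "w \<bullet> (?N *v w) / 2"])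
    show "v \<bullet> (?N *v v) / 2 > 0" "w \<bullet> (?N *v w) / 2 > 0"
      using pos \<open>v \<noteq> 0\<close> w(2) by auto
    show "(t *\<^sub>R v + s *\<^sub>R w) \<bullet> (?N *v (t *\<^sub>R v + s *\<^sub>R w)) =
        2 * (v \<bullet> (?N *v v) / 2 * t\<^sup>2 + w \<bullet> (?N *v w) / 2 * s\<^sup>2)" for t s
      using c N_sym[of v w]
      by (simp add: matrix_vector_right_distrib matrix_vector_mult_scaleR inner_add_left
          inner_add_right inner_commute power2_eq_square algebra_simps)
  qed
qed

text \<open>\<open>w\<close> is \<open>v\<close> turned by a right angle, hence of the same length;
  the coordinates are the inner products with \<open>v\<close> and \<open>w\<close> divided by the
  common squared length.\<close>

lemma decompose_real2:
  fixes v z :: "real^2"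
  assumes "v \<noteq> 0"
  defines "w \<equiv> vector [- v $ 2, v $ 1] :: real^2"
  obtains t s where "z = t *\<^sub>R v + s *\<^sub>R w"
proof -
  let ?n = "(v $ 1)\<^sup>2 + (v $ 2)\<^sup>2"
  have n: "?n \<noteq> 0"
    using assms(1) by (simp add: vec_eq_iff forall_2 sum_power2_eq_zero_iff)
  have "z = ((z $ 1 * v $ 1 + z $ 2 * v $ 2) / ?n) *\<^sub>R v + ((z $ 2 * v $ 1 - z $ 1 * v $ 2) / ?n) *\<^sub>R w"
    using n by (simp add: vec_eq_iff forall_2 w_def nonzero_eq_divide_eq flip: add_divide_distrib diff_divide_distrib)
      (simp add: algebra_simps power2_eq_square)
  with that show thesis .
qed

text \<open>Continuity pulls the neighbourhood of \<open>f x\<close> back to one of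
  \<open>x\<close>. This serves to restrict the mixture to lines.\<close>

lemma modes_compose:
  assumes "f x \<in> modes M" "isCont f x"
  shows "x \<in> modes (\<lambda>y. M (f y))"
  using assms eventually_compose_filterlim[of _ "nhds (f x)" f "nhds x"]
  by (auto simp: modes_def isCont_def tendsto_at_iff_tendsto_nhds)

text \<open>The derivative is \<open>- 2 * s\<close> times a positive number. The constants
  \<open>p\<close> and \<open>r\<close> stand for the exponents contributed by the fixed other
  coordinate.\<close>

lemma gaussian_mixture_not_mode:
  fixes a b :: real
  assumes "0 \<le> a" "0 \<le> b" "a > 0 \<or> b > 0" "Q > 0" "R > 0" "s \<noteq> 0"
  shows "s \<notin> modes (\<lambda>s. a * exp (p - Q * s\<^sup>2) + b * exp (r - R * s\<^sup>2))"
proof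
  let ?h = "\<lambda>s. a * exp (p - Q * s\<^sup>2) + b * exp (r - R * s\<^sup>2)"
  assume "s \<in> modes ?h"
  then obtain d where d: "d > 0" "\<And>u. \<bar>u - s\<bar> < d \<Longrightarrow> ?h u \<le> ?h s"
    unfolding modes_real_iff by blast
  have der: "(?h has_real_derivative
      - 2 * s * (Q * a * exp (p - Q * s\<^sup>2) + R * b * exp (r - R * s\<^sup>2))) (at s)"
    by (auto intro!: derivative_eq_intros simp: algebra_simps)
  have "- 2 * s * (Q * a * exp (p - Q * s\<^sup>2) + R * b * exp (r - R * s\<^sup>2)) = 0"
    by (rule DERIV_local_max[OF der d(1)]) (use d(2) in \<open>auto simp: abs_minus_commute\<close>)
  moreover have "Q * a * exp (p - Q * s\<^sup>2) + R * b * exp (r - R * s\<^sup>2) > 0"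
    using assms(1-5) by (auto intro: add_pos_nonneg add_nonneg_pos)
  ultimately show False using \<open>s \<noteq> 0\<close> by simp
qed

theorem theorem4p5:
  fixes \<mu>1 \<mu>2 :: "real^2" and S1 S2 :: "real^2^2" and c :: real
    and f1 f2 M :: "real^2 \<Rightarrow> real"
  defines "f1 \<equiv> bivariate_normal_density \<mu>1 S1"
    and "f2 \<equiv> bivariate_normal_density \<mu>2 S2"
    and "M \<equiv> mixture c f1 f2"
  assumes "pos_def_symmetric S1" and "pos_def_symmetric S2"
    and "0 \<le> c" and "c \<le> 1"
    and "\<not> proportional S1 S2"
    and "codirectional \<mu>1 S1 \<mu>2 S2"
  shows "finite (modes M) \<and> card (modes M) \<le> 2"
proof -
  define v where "v = \<mu>1 - \<mu>2"
  define w :: "real^2" where "w = vector [- v $ 2, v $ 1]"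
  have v: "is_eigenvector S1 v" "is_eigenvector S2 v"
    using assms(9) by (simp_all add: codirectional_def v_def)
  then have "v \<noteq> 0" by (simp add: is_eigenvector_def)
  then have w: "v \<bullet> w = 0" "w \<noteq> 0"
    by (auto simp: w_def inner_vec_def sum_2 vec_eq_iff forall_2)
  obtain P Q where PQ: "P > 0" "Q > 0"
    "\<And>t s. (t *\<^sub>R v + s *\<^sub>R w) \<bullet> (matrix_inv S1 *v (t *\<^sub>R v + s *\<^sub>R w)) = 2 * (P * t\<^sup>2 + Q * s\<^sup>2)"
    by (rule quadratic_form_inverse_diagonal[OF assms(4) v(1) w]) (rule that)
  obtain P' Q' where PQ': "P' > 0" "Q' > 0"
    "\<And>t s. (t *\<^sub>R v + s *\<^sub>R w) \<bullet> (matrix_inv S2 *v (t *\<^sub>R v + s *\<^sub>R w)) = 2 * (P' * t\<^sup>2 + Q' * s\<^sup>2)"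
    by (rule quadratic_form_inverse_diagonal[OF assms(5) v(2) w]) (rule that)
  define a where "a = c / (2 * pi * sqrt (det S1))"
  define b where "b = (1 - c) / (2 * pi * sqrt (det S2))"
  have "det S1 > 0" "det S2 > 0"
    using pos_def_symmetric_det_pos assms(4,5) by auto
  \<comment> \<open>Only a disjunction holds, since one weight vanishes at \<open>c = 0\<close> and
    at \<open>c = 1\<close>.\<close>
  then have ab: "0 \<le> a" "0 \<le> b" "a > 0 \<or> b > 0"
    using assms(6,7) by (auto simp: a_def b_def zero_less_divide_iff)
  define X where "X t s = \<mu>2 + (t *\<^sub>R v + s *\<^sub>R w)" for t s
  have M: "M (X t s) = a * exp (- P * (t - 1)\<^sup>2 - Q * s\<^sup>2) + b * exp (- P' * t\<^sup>2 - Q' * s\<^sup>2)" for t s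
  proof -
    \<comment> \<open>In these coordinates \<open>\<mu>2\<close> is the origin and
      \<open>\<mu>1\<close> is the point \<open>t = 1\<close>, \<open>s = 0\<close>.\<close>
    have X: "X t s - \<mu>1 = (t - 1) *\<^sub>R v + s *\<^sub>R w" "X t s - \<mu>2 = t *\<^sub>R v + s *\<^sub>R w"
      by (simp_all add: X_def v_def algebra_simps)
    show ?thesis
      unfolding M_def mixture_def f1_def f2_def bivariate_normal_density_def X PQ(3) PQ'(3)
      by (simp add: a_def b_def add_divide_distrib)
  qed
  define g where "g = (\<lambda>t. a * exp (- P * (t - 1)\<^sup>2) + b * exp (- P' * t\<^sup>2))"
  have cont: "isCont (\<lambda>t. X t s) t" "isCont (X t) s" for t s
    unfolding X_def by (intro continuous_intros)+
  have "modes M \<subseteq> (\<lambda>t. X t 0) ` modes g"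
  proof
    fix x assume x: "x \<in> modes M"
    obtain t s where "x - \<mu>2 = t *\<^sub>R v + s *\<^sub>R w"
      using decompose_real2[OF \<open>v \<noteq> 0\<close>] unfolding w_def .
    then have xX: "x = X t s" by (simp add: X_def algebra_simps)
    \<comment> \<open>A mode of \<open>M\<close> remains a mode along each coordinate line through
      it: the line in direction \<open>w\<close> forces \<open>s = 0\<close>, and then the line in
      direction \<open>v\<close> carries the function \<open>g\<close>.\<close>
    have "s \<in> modes (\<lambda>s. M (X t s))"
      using modes_compose[of "X t" s M] cont x xX by simp
    then have "s = 0"
      using gaussian_mixture_not_mode[OF ab PQ(2) PQ'(2)] unfolding M by blast
    then have "t \<in> modes (\<lambda>t. M (X t 0))"
      using modes_compose[of "\<lambda>t. X t 0" t M] cont x xX by simp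
    then have "t \<in> modes g" by (simp add: M g_def)
    with xX \<open>s = 0\<close> show "x \<in> (\<lambda>t. X t 0) ` modes g" by blast
  qed
  moreover have "finite (modes g)" "card (modes g) \<le> 2"
    using gaussian_mixture_modes[OF ab PQ(1) PQ'(1)] by (simp_all add: g_def)
  ultimately show ?thesis
    by (meson card_image_le card_mono finite_imageI finite_subset le_trans)
qed

end
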